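(* The numbers $T(n,k)=\binom{n}{2k}\binom{2k}{k}$ ($n,k\ge 0$) are asymptotically normal, by a central limit theorem and by a local limit theorem on $\mathbb{R}$. That is, with $p(n,k)=T(n,k)/\sum_{j=0}^{n}T(n,j)$ and with $\mu_n$ and $\sigma_n^2$ the mean and variance of the probability distribution $k\mapsto p(n,k)$, $$\lim_{n\to\infty}\sup_{x\in\mathbb{R}}\left|\sum_{k\le\mu_n+x\sigma_n}p(n,k)-\frac{1}{\sqrt{2\pi}}\int_{-\infty}^x e^{-t^2/2}\,dt\right|=0$$ and $$\lim_{n\to\infty}\sup_{x\in\mathbb{R}}\left|\sigma_n\, p(n,\lfloor\mu_n+x\sigma_n\rfloor)-\frac{1}{\sqrt{2\pi}}e^{-x^2/2}\right|=0.$$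
   Context: Here $T(n,k)=\frac{n!}{k!\,k!\,(n-2k)!}$ for $0\le k\le\lfloor n/2\rfloor$, and $T(n,k)=0$ (hence $p(n,k)=0$) for all other integers $k$. The mean and variance are $\mu_n=\sum_k k\,p(n,k)$ and $\sigma_n^2=\sum_k k^2p(n,k)-\mu_n^2$, with $\sigma_n\ge 0$. *)

theory Defs
  imports "HOL-Analysis.Analysis"
begin

text \<open>The second index ranges over all integers, since the local limit theorem evaluates the
  distribution at \<open>\<lfloor>mean_T n + x * stddev_T n\<rfloor>\<close> for arbitrary real \<open>x\<close>; see \<open>T_num_eq_fact\<close> and \<open>T_num_eq_0\<close>.\<close>

definition T_num :: "nat \<Rightarrow> int \<Rightarrow> nat" where
  "T_num n k = (if k < 0 then 0 else (n choose (2 * nat k)) * ((2 * nat k) choose nat k))"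

definition p_T :: "nat \<Rightarrow> int \<Rightarrow> real" where
  "p_T n k = real (T_num n k) / real (\<Sum>j=0..int n. T_num n j)"

text \<open>Since \<open>p_T n\<close> vanishes outside \<open>{0..int n}\<close>, sums over all integers are written as sums over
  this finite set (\<open>sum\<close> over an infinite set would be 0).\<close>

definition mean_T :: "nat \<Rightarrow> real" where
  "mean_T n = (\<Sum>k=0..int n. real_of_int k * p_T n k)"

definition variance_T :: "nat \<Rightarrow> real" where
  "variance_T n = (\<Sum>k=0..int n. (real_of_int k)\<^sup>2 * p_T n k) - (mean_T n)\<^sup>2"

definition stddev_T :: "nat \<Rightarrow> real" where
  "stddev_T n = sqrt (variance_T n)"

definition cdf_T :: "nat \<Rightarrow> real \<Rightarrow> real" where
  "cdf_T n y = (\<Sum>k | k \<in> {0..int n} \<and> real_of_int k \<le> y. p_T n k)"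

lemma T_num_eq_fact:
  assumes "2 * k \<le> n"
  shows "real (T_num n (int k)) = fact n / (fact k * fact k * fact (n - 2 * k))"
  using assms by (simp add: T_num_def binomial_fact)

lemma T_num_eq_0:
  assumes "k < 0 \<or> int n < 2 * k"
  shows "T_num n k = 0"
  using assms by (auto simp: T_num_def intro!: binomial_eq_0)

lemma p_T_eq_0: "k \<notin> {0..int n} \<Longrightarrow> p_T n k = 0"
  using T_num_eq_0[of k n] by (auto simp: p_T_def)

lemma p_T_nonneg: "p_T n k \<ge> 0"
  unfolding p_T_def by (intro divide_nonneg_nonneg of_nat_0_le_iff)

lemma sum_p_T: "(\<Sum>k=0..int n. p_T n k) = 1"
proof -
  have "T_num n 0 \<le> (\<Sum>j=0..int n. T_num n j)"
    by (rule member_le_sum) auto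
  moreover have "T_num n 0 = 1"
    by (simp add: T_num_def)
  ultimately have "(\<Sum>j=0..int n. T_num n j) \<noteq> 0"
    by linarith
  then have "real (\<Sum>j=0..int n. T_num n j) \<noteq> 0"
    by (simp only: of_nat_eq_0_iff not_False_eq_True)
  then show ?thesis
    unfolding p_T_def sum_divide_distrib[symmetric] of_nat_sum[symmetric] by (rule divide_self)
qed

end

theory Submission
  imports Defs "HOL-Probability.Probability" "HOL-Real_Asymp.Real_Asymp"
begin

text \<open>From \<open>T(n,k+1) (k+1)\<^sup>2 = T(n,k) (n-2k) (n-2k-1)\<close> the logarithmic increment of \<open>T(n,\<cdot>)\<close> at \<open>k\<close> is
  \<open>- 18 (k - n/3) / n + O(1/n)\<close> as long as \<open>k - n/3 = O(\<surd>n)\<close>. Summing increments shows that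
  \<open>T(n, n/3 + u \<surd>(n/18)) / T(n, n/3)\<close> tends to \<open>exp (-u\<^sup>2/2)\<close> locally uniformly, while a cruder one-sided
  bound on the increments, valid for all \<open>k\<close>, dominates it by a constant times \<open>exp (-u\<^sup>2/12)\<close>. Reading
  sums over \<open>k\<close> as integrals of step functions, dominated convergence gives the normalising constant,
  \<open>\<mu> = n/3 + o(\<surd>n)\<close> and \<open>\<sigma>\<^sup>2 \<sim> n/18\<close>; this turns the uniform convergence into the local limit theorem.
  By Scheffe's lemma the step densities \<open>\<sigma> p(n, \<lfloor>\<mu> + x \<sigma>\<rfloor>)\<close> then converge in \<open>L\<^sup>1\<close>, which is the
  central limit theorem, uniformly in \<open>x\<close>.\<close>

section \<open>Gaussian domination\<close>

text \<open>The ratio of neighbouring terms, cleared of denominators so that it holds for every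
  \<open>k\<close>: past the support the left side is 0, and on the right either the coefficient or
  one of the factors \<open>n - 2k\<close>, \<open>n - 2k - 1\<close> vanishes.\<close>

lemma T_num_Suc:
  "real (T_num n (int (Suc k))) * (real k + 1)\<^sup>2 =
   real (T_num n (int k)) * ((real n - 2 * real k) * (real n - 2 * real k - 1))"
proof (cases "2 * Suc k \<le> n")
  case True
  define d where "d = n - 2 * Suc k"
  have n: "n = d + 2 * k + 2" using True by (simp add: d_def)
  have f: "fact (n - 2 * k) = (real d + 2) * (real d + 1) * fact d" "n - 2 * Suc k = d"
    by (simp_all add: n algebra_simps)
  have "real (T_num n (int (Suc k))) * (real k + 1)\<^sup>2 = fact n / (fact k * fact k * fact d)"
  proof -
    have "fact (Suc k) = (real k + 1) * fact k" "real k + 1 \<noteq> 0" by auto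
    then show ?thesis
      unfolding T_num_eq_fact[OF True] f by (simp add: power2_eq_square divide_simps del: fact_Suc)
  qed
  moreover have "real (T_num n (int k)) * ((real d + 2) * (real d + 1)) = fact n / (fact k * fact k * fact d)"
  proof -
    have "2 * k \<le> n" using True by simp
    moreover have "(real d + 2) * (real d + 1) \<noteq> 0" by auto
    ultimately show ?thesis
      unfolding T_num_eq_fact[OF \<open>2 * k \<le> n\<close>] f by (simp only: times_divide_eq_left divide_eq_eq mult_eq_0_iff fact_nonzero) (simp add: field_simps)
  qed
  moreover have "real n - 2 * real k = real d + 2" "real n - 2 * real k - 1 = real d + 1" by (simp_all add: n)
  ultimately show ?thesis by (simp only:)
next
  case False
  then have "T_num n (int (Suc k)) = 0" by (intro T_num_eq_0) auto
  moreover have "n < 2 * k \<or> n = 2 * k \<or> n = 2 * k + 1"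
    using False by presburger
  then have "T_num n (int k) = 0 \<or> n = 2 * k \<or> n = 2 * k + 1"
    using T_num_eq_0[of "int k" n] by auto
  ultimately show ?thesis by auto
qed

lemma T_num_pos: "2 * k \<le> n \<Longrightarrow> 0 < T_num n (int k)"
  by (simp add: T_num_def zero_less_binomial_iff)

text \<open>The weight uses exponent 3/n where 9/n is the true Gaussian rate. This slack pays for
  crude estimates: with v = k - n/3 the ratio of neighbours is at most exp ((6 - 6v)/n), while the
  weight grows by exp ((6v + 3)/n), which leaves exp (9/n).\<close>

lemma T_num_step_up:
  assumes "n div 3 \<le> k" "0 < n"
  shows "real (T_num n (int (Suc k))) * exp (3 / n * (real (Suc k) - n / 3)\<^sup>2)
     \<le> real (T_num n (int k)) * exp (3 / n * (real k - n / 3)\<^sup>2) * exp (9 / n)"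
proof (cases "2 * Suc k \<le> n")
  case False
  then have "T_num n (int (Suc k)) = 0" by (intro T_num_eq_0) auto
  then show ?thesis by simp
next
  case True
  define v where "v = real k - n / 3"
  have v1: "v + 1 = real (Suc k) - n / 3" by (simp add: v_def)
  define q where "q = (real n - 2 * real k) / (real k + 1)"
  have k1: "real k + 1 \<le> n" using True by simp
  have "n \<le> 3 * k + 2" using assms(1) by linarith
  then have "real n \<le> 3 * real k + 2" by (simp flip: of_nat_le_iff[where 'a = real])
  then have v: "3 * v \<ge> - 2" and k3: "n / 3 \<le> real k + 1"
    unfolding v_def by simp_all
  have q: "q = 1 - (3 * v + 1) / (real k + 1)"
    unfolding q_def v_def by (simp add: field_simps)
  have q0: "0 \<le> q" using True unfolding q_def by (simp add: field_simps)
  \<comment> \<open>For 3v + 1 >= 0 the denominator is enlarged to \<open>n\<close>. Otherwise v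
    lies in [-2/3, -1/3), a case caused by rounding in \<open>n div 3\<close>; the numerator is then
    at most 1 and the denominator at least n/3.\<close>
  have "- (3 * v + 1) / (real k + 1) \<le> (3 - 3 * v) / n"
  proof (cases "3 * v + 1 \<ge> 0")
    case True
    then have "(3 * v + 1) / n \<le> (3 * v + 1) / (real k + 1)"
      using k1 by (intro divide_left_mono) auto
    then show ?thesis using assms(2) by (simp add: field_simps)
  next
    case False
    then have "- (3 * v + 1) / (real k + 1) \<le> 1 / (n / 3)"
      using v k3 assms(2) by (intro frac_le) auto
    also have "\<dots> \<le> (3 - 3 * v) / n"
      using False assms(2) by (simp add: field_simps)
    finally show ?thesis .
  qed
  then have "q \<le> 1 + (3 - 3 * v) / n" unfolding q minus_divide_left[symmetric] by simp
  also have "\<dots> \<le> exp ((3 - 3 * v) / n)" by (rule exp_ge_add_one_self)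
  finally have "q\<^sup>2 \<le> (exp ((3 - 3 * v) / n))\<^sup>2" using q0 by (rule power_mono)
  then have q2: "q\<^sup>2 \<le> exp ((6 - 6 * v) / n)"
    by (simp add: power2_eq_square exp_add[symmetric] add_divide_distrib[symmetric])
  have "real (T_num n (int (Suc k))) * (real k + 1)\<^sup>2 \<le> real (T_num n (int k)) * (real n - 2 * real k)\<^sup>2"
    unfolding T_num_Suc power2_eq_square[of "_ - _"] using True by (intro mult_left_mono) auto
  then have "real (T_num n (int (Suc k))) \<le> real (T_num n (int k)) * q\<^sup>2"
    unfolding q_def by (simp add: field_simps)
  also have "\<dots> \<le> real (T_num n (int k)) * exp ((6 - 6 * v) / n)"
    using q2 by (intro mult_left_mono) auto
  finally have "real (T_num n (int (Suc k))) * exp (3 / n * (v + 1)\<^sup>2)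
      \<le> real (T_num n (int k)) * exp ((6 - 6 * v) / n) * exp (3 / n * (v + 1)\<^sup>2)"
    by (rule mult_right_mono) simp
  also have "\<dots> = real (T_num n (int k)) * exp (3 / n * v\<^sup>2) * exp (9 / n)"
  proof -
    have "(6 - 6 * v) / n + 3 / n * (v + 1)\<^sup>2 = 3 / n * v\<^sup>2 + 9 / n"
      using assms(2) by (simp add: field_simps power2_eq_square)
    then show ?thesis by (simp add: exp_add[symmetric] mult.assoc)
  qed
  finally show ?thesis unfolding v1 unfolding v_def .
qed

text \<open>Mirror image of the upward step: below n/3 the number 3v + 2 is negative, so enlarging
  the denominator \<open>n - 2k - 1\<close> to \<open>n\<close> goes the right way. Only exp (1/n)
  is lost; it is weakened to exp (9/n) to match the other direction.\<close>

lemma T_num_step_down: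
  assumes "k < n div 3"
  shows "real (T_num n (int k)) * exp (3 / n * (real k - n / 3)\<^sup>2)
     \<le> real (T_num n (int (Suc k))) * exp (3 / n * (real (Suc k) - n / 3)\<^sup>2) * exp (9 / n)"
proof -
  define v where "v = real k - n / 3"
  have v1: "v + 1 = real (Suc k) - n / 3" by (simp add: v_def)
  define q where "q = (real k + 1) / (real n - 2 * real k - 1)"
  have n: "3 * real k + 3 \<le> n" using assms by linarith
  have q: "q = 1 + (3 * v + 2) / (real n - 2 * real k - 1)"
    unfolding q_def v_def using n by (simp add: field_simps)
  have q0: "0 \<le> q" using n unfolding q_def by simp
  have "- (3 * v + 2) / n \<le> - (3 * v + 2) / (real n - 2 * real k - 1)"
    using n by (intro divide_left_mono) (auto simp: v_def)
  then have "(3 * v + 2) / (real n - 2 * real k - 1) \<le> (3 * v + 2) / n"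
    unfolding minus_divide_left by linarith
  then have "q \<le> 1 + (3 * v + 2) / n" unfolding q by simp
  also have "\<dots> \<le> exp ((3 * v + 2) / n)" by (rule exp_ge_add_one_self)
  finally have "q\<^sup>2 \<le> (exp ((3 * v + 2) / n))\<^sup>2" using q0 by (rule power_mono)
  then have q2: "q\<^sup>2 \<le> exp ((6 * v + 4) / n)"
    by (simp add: power2_eq_square exp_add[symmetric] add_divide_distrib[symmetric])
  have "real (T_num n (int k)) * (real n - 2 * real k - 1)\<^sup>2 \<le> real (T_num n (int (Suc k))) * (real k + 1)\<^sup>2"
    unfolding T_num_Suc power2_eq_square[of "_ - 1"] using n by (intro mult_left_mono mult_right_mono) auto
  then have "real (T_num n (int k)) \<le> real (T_num n (int (Suc k))) * q\<^sup>2"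
    unfolding q_def using n by (simp add: field_simps)
  also have "\<dots> \<le> real (T_num n (int (Suc k))) * exp ((6 * v + 4) / n)"
    using q2 by (intro mult_left_mono) auto
  finally have "real (T_num n (int k)) * exp (3 / n * v\<^sup>2)
      \<le> real (T_num n (int (Suc k))) * exp ((6 * v + 4) / n) * exp (3 / n * v\<^sup>2)"
    by (rule mult_right_mono) simp
  also have "\<dots> = real (T_num n (int (Suc k))) * exp (3 / n * (v + 1)\<^sup>2) * exp (1 / n)"
  proof -
    have "(6 * v + 4) / n + 3 / n * v\<^sup>2 = 3 / n * (v + 1)\<^sup>2 + 1 / n"
      using n by (simp add: field_simps power2_eq_square)
    then show ?thesis by (simp add: exp_add[symmetric] mult.assoc)
  qed
  also have "\<dots> \<le> real (T_num n (int (Suc k))) * exp (3 / n * (v + 1)\<^sup>2) * exp (9 / n)"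
    by (intro mult_left_mono) (auto simp: divide_right_mono)
  finally show ?thesis unfolding v1 unfolding v_def .
qed

text \<open>Steps are chained outwards from \<open>n div 3\<close>. At most \<open>n\<close> of them
  are made, so the losses multiply to at most exp 9; the weight at the starting point adds exp
  3.\<close>

lemma T_num_le_gaussian_nat:
  assumes "0 < n"
  shows "real (T_num n (int k)) \<le> exp 12 * real (T_num n (int (n div 3))) * exp (- (3 / n * (real k - n / 3)\<^sup>2))"
proof -
  define m where "m = n div 3"
  define F where "F k = real (T_num n (int k)) * exp (3 / n * (real k - n / 3)\<^sup>2)" for k
  have F0: "0 \<le> F k" for k by (simp add: F_def)
  have "F k \<le> F m * exp 9"
  proof (cases "k \<le> n")
    case False
    then have "F k = 0" by (auto simp: F_def intro!: T_num_eq_0)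
    then show ?thesis using F0 by simp
  next
    case kn: True
    have up: "F (m + i) \<le> F m * exp (9 / n) ^ i" for i
    proof (induction i)
      case (Suc i)
      have "F (Suc (m + i)) \<le> F (m + i) * exp (9 / n)"
        using T_num_step_up[of n "m + i"] assms by (simp add: F_def m_def)
      also have "\<dots> \<le> F m * exp (9 / n) ^ i * exp (9 / n)"
        using Suc by (intro mult_right_mono) auto
      finally show ?case by (simp add: mult_ac)
    qed simp
    have down: "i \<le> m \<Longrightarrow> F (m - i) \<le> F m * exp (9 / n) ^ i" for i
    proof (induction i)
      case (Suc i)
      then have i: "m - i = Suc (m - Suc i)" by simp
      have "F (m - Suc i) \<le> F (m - i) * exp (9 / n)"
        using T_num_step_down[of "m - Suc i" n] Suc.prems unfolding F_def i by (simp add: m_def)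
      also have "\<dots> \<le> F m * exp (9 / n) ^ i * exp (9 / n)"
        using Suc by (intro mult_right_mono) auto
      finally show ?case by (simp add: mult_ac)
    qed simp
    \<comment> \<open>The number of steps is the distance from \<open>k\<close> to \<open>m\<close>,
      at most \<open>n\<close> on either side.\<close>
    have "\<exists>i\<le>n. F k \<le> F m * exp (9 / n) ^ i"
    proof (cases "m \<le> k")
      case True
      then show ?thesis using up[of "k - m"] kn by (intro exI[of _ "k - m"]) auto
    next
      case False
      then show ?thesis using down[of "m - k"]
        by (intro exI[of _ "m - k"]) (auto simp: m_def)
    qed
    then obtain i where i: "i \<le> n" "F k \<le> F m * exp (9 / n) ^ i" by blast
    note i(2)
    also have "exp (9 / real n) ^ i \<le> exp (9 / n) ^ n"
      using i(1) by (intro power_increasing) auto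
    also have "exp (9 / real n) ^ n = exp 9"
      using assms by (simp add: exp_of_nat_mult[symmetric])
    finally show ?thesis using F0 by (simp add: mult_left_mono)
  qed
  also have "F m \<le> real (T_num n (int m)) * exp 3"
  proof -
    have "\<bar>real m - n / 3\<bar> \<le> 1" unfolding m_def by linarith
    then have "(real m - n / 3)\<^sup>2 \<le> 1" by (simp add: abs_square_le_1)
    then have "3 / n * (real m - n / 3)\<^sup>2 \<le> 3 * 1"
      using assms by (intro mult_mono) (auto simp: divide_simps)
    then show ?thesis unfolding F_def by (intro mult_left_mono) auto
  qed
  finally have "F k \<le> exp 12 * real (T_num n (int m))"
    using exp_add[of 9 "3::real"] by (simp add: mult_ac)
  then have "F k * exp (- (3 / n * (real k - n / 3)\<^sup>2)) \<le> 
     exp 12 * real (T_num n (int m)) * exp (- (3 / n * (real k - n / 3)\<^sup>2))"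
    by (rule mult_right_mono) simp
  then show ?thesis by (simp add: F_def m_def mult.assoc exp_add[symmetric])
qed

section \<open>Local approximation by a Gaussian\<close>

lemma abs_diff_le_of_steps:
  fixes D :: "nat \<Rightarrow> real"
  assumes "a \<le> b" "\<And>j. a \<le> j \<Longrightarrow> j < b \<Longrightarrow> \<bar>D (Suc j) - D j\<bar> \<le> c"
  shows "\<bar>D b - D a\<bar> \<le> (real b - real a) * c"
  using assms
proof (induction b rule: dec_induct)
  case (step i)
  have "\<bar>D i - D a\<bar> \<le> (real i - real a) * c"
    using step by auto
  moreover have "\<bar>D (Suc i) - D i\<bar> \<le> c" using step by simp
  ultimately show ?case by (simp add: algebra_simps)
qed simp

text \<open>The three factors of the recurrence are n/3 times 1 + z with small z, so the logarithm
  of the ratio is ln (1 + z1) + ln (1 + z2) - 2 ln (1 + z3). The linear parts give -18x - 9h; the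
  rest is quadratic, hence O(1/n) in a window of width O(sqrt n).\<close>

lemma ln_T_num_step:
  assumes B: "1 \<le> B" "24 * B \<le> sqrt n" and k: "\<bar>real k - n / 3\<bar> \<le> B * sqrt n"
  shows "2 * k \<le> n"
    and "\<bar>ln (real (T_num n (int (Suc k)))) - ln (real (T_num n (int k))) + 18 * (real k - n / 3) / n\<bar>
           \<le> (288 * B\<^sup>2 + 117) / n"
proof -
  define w where "w = sqrt n"
  have w: "24 \<le> w" and nw: "real n = w\<^sup>2" using B by (auto simp: w_def)
  define h where "h = 1 / real n"
  define x where "x = (real k - n / 3) / n"
  define z1 z2 z3 where "z1 = - 6 * x" and "z2 = - 6 * x - 3 * h" and "z3 = 3 * x + 3 * h"
  have n576: "576 \<le> real n"
    unfolding nw using power_mono[OF w, of 2] by simp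
  have h: "0 < h" "h \<le> 1 / 576" using n576 by (auto simp: h_def field_simps)
  have xw: "\<bar>x\<bar> \<le> B / w"
  proof -
    have "\<bar>x\<bar> \<le> (B * w) / n"
      unfolding x_def abs_divide using k by (simp add: w_def divide_right_mono)
    then show ?thesis using w by (simp add: nw power2_eq_square)
  qed
  have "B / w \<le> 1 / 24" using B(2) w by (subst pos_divide_le_eq) (auto simp flip: w_def)
  \<comment> \<open>The hypothesis \<open>24 * B \<le> sqrt n\<close> serves to keep all three z
    within 1/2, where |ln (1 + z) - z| <= 2 z^2.\<close>
  then have x24: "\<bar>x\<bar> \<le> 1 / 24" using xw by linarith
  have x2: "x\<^sup>2 \<le> B\<^sup>2 * h"
    using power_mono[OF xw, of 2] by (simp add: h_def nw power_divide)
  have h2: "h\<^sup>2 \<le> h" unfolding power2_eq_square using h by (intro mult_left_le) auto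
  have z: "\<bar>z1\<bar> \<le> 1/2" "\<bar>z2\<bar> \<le> 1/2" "\<bar>z3\<bar> \<le> 1/2"
    using x24 h unfolding z1_def z2_def z3_def by linarith+
  have e1: "real n - 2 * real k = n / 3 * (1 + z1)"
    using n576 by (simp add: z1_def x_def field_simps)
  have e2: "real n - 2 * real k - 1 = n / 3 * (1 + z2)"
    using n576 by (simp add: z2_def x_def h_def field_simps)
  have e3: "real k + 1 = n / 3 * (1 + z3)"
    using n576 by (simp add: z3_def x_def h_def field_simps)
  have "192 * (1/2) \<le> n / 3 * (1 + z1)"
    using n576 z by (intro mult_mono) auto
  then have nk: "96 \<le> real n - 2 * real k" unfolding e1 by simp
  then show k2: "2 * k \<le> n" by linarith
  have pos: "0 < real (T_num n (int k))" "0 < real (T_num n (int (Suc k)))"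
    using T_num_pos[of k n] T_num_pos[of "Suc k" n] nk by simp_all
  have "real (T_num n (int (Suc k))) * (1 + z3)\<^sup>2 = real (T_num n (int k)) * ((1 + z1) * (1 + z2))"
  proof -
    have "real (T_num n (int (Suc k))) * (n / 3 * (1 + z3))\<^sup>2
        = real (T_num n (int k)) * ((n / 3 * (1 + z1)) * (n / 3 * (1 + z2)))"
      unfolding e1[symmetric] e2[symmetric] e3[symmetric] by (rule T_num_Suc)
    then have "(n / 3)\<^sup>2 * (real (T_num n (int (Suc k))) * (1 + z3)\<^sup>2)
        = (n / 3)\<^sup>2 * (real (T_num n (int k)) * ((1 + z1) * (1 + z2)))"
      by (simp only: power2_eq_square mult_ac)
    then show ?thesis using n576 by (subst (asm) mult_left_cancel) auto
  qed
  then have ln_eq: "ln (real (T_num n (int (Suc k))) * (1 + z3)\<^sup>2) = ln (real (T_num n (int k)) * ((1 + z1) * (1 + z2)))"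
    by simp
  have "ln (real (T_num n (int (Suc k)))) + 2 * ln (1 + z3) = ln (real (T_num n (int k))) + (ln (1 + z1) + ln (1 + z2))"
  proof -
    have "0 < 1 + z1" "0 < 1 + z2" "0 < 1 + z3" using z by linarith+
    then show ?thesis using pos ln_eq by (simp add: ln_mult_pos ln_realpow)
  qed
  moreover note abs_ln_one_plus_x_minus_x_bound[OF z(1)] abs_ln_one_plus_x_minus_x_bound[OF z(2)]
    abs_ln_one_plus_x_minus_x_bound[OF z(3)]
  moreover have "z1\<^sup>2 \<le> 36 * (B\<^sup>2 * h)" using x2 by (simp add: z1_def power2_eq_square)
  \<comment> \<open>This is (a + b)^2 <= 2a^2 + 2b^2, obtained from the nonnegative square of a - b;
    likewise for \<open>z3\<close>.\<close>
  moreover have "z2\<^sup>2 \<le> 72 * (B\<^sup>2 * h) + 18 * h"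
    using x2 h2 sum_squares_ge_zero[of "6 * x - 3 * h" 0]
    by (simp add: z2_def power2_eq_square algebra_simps)
  moreover have "z3\<^sup>2 \<le> 18 * (B\<^sup>2 * h) + 18 * h"
    using x2 h2 sum_squares_ge_zero[of "3 * x - 3 * h" 0]
    by (simp add: z3_def power2_eq_square algebra_simps)
  moreover have "z1 + z2 - 2 * z3 = - 18 * x - 9 * h" by (simp add: z1_def z2_def z3_def)
  \<comment> \<open>Remainders 2 z1^2 + 2 z2^2 + 4 z3^2 contribute 72 + 144 + 72 = 288 and 36 + 72 =
    108; the linear term 9h raises 108 to 117.\<close>
  ultimately have "\<bar>ln (real (T_num n (int (Suc k)))) - ln (real (T_num n (int k))) + 18 * x\<bar>
      \<le> 288 * (B\<^sup>2 * h) + 117 * h"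
    using h by linarith
  then show "\<bar>ln (real (T_num n (int (Suc k)))) - ln (real (T_num n (int k))) + 18 * (real k - n / 3) / n\<bar>
           \<le> (288 * B\<^sup>2 + 117) / n"
    by (simp add: x_def h_def add_divide_distrib)
qed

text \<open>Adding 9/n (k - n/3)^2 cancels the drift -18 (k - n/3)/n and leaves an extra 9/n, so
  each increment is at most (288 B^2 + 126)/n. The window holds at most 2 B sqrt n steps.\<close>

lemma ln_T_num_diff:
  assumes B: "1 \<le> B" "24 * B \<le> sqrt n" and ab: "a \<le> b"
    and a: "\<bar>real a - n / 3\<bar> \<le> B * sqrt n" and b: "\<bar>real b - n / 3\<bar> \<le> B * sqrt n"
  shows "\<bar>(ln (real (T_num n (int b))) + 9 / n * (real b - n / 3)\<^sup>2)
        - (ln (real (T_num n (int a))) + 9 / n * (real a - n / 3)\<^sup>2)\<bar> \<le> 2 * B * (288 * B\<^sup>2 + 126) / sqrt n"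
proof -
  define w where "w = sqrt n"
  have w: "24 \<le> w" and nw: "real n = w\<^sup>2" using B by (auto simp: w_def)
  then have n0: "0 < real n" by simp
  define D where "D k = ln (real (T_num n (int k))) + 9 / n * (real k - n / 3)\<^sup>2" for k
  have "\<bar>D b - D a\<bar> \<le> (real b - real a) * ((288 * B\<^sup>2 + 126) / n)"
  proof (rule abs_diff_le_of_steps[OF ab])
    fix j assume j: "a \<le> j" "j < b"
    have "\<bar>real j - n / 3\<bar> \<le> B * sqrt n" using a b j by linarith
    note * = ln_T_num_step(2)[OF B this]
    have "D (Suc j) - D j = ln (real (T_num n (int (Suc j)))) - ln (real (T_num n (int j))) + 18 * (real j - n / 3) / n + 9 / n"
      using n0 by (simp add: D_def field_simps power2_eq_square)
    moreover have "(288 * B\<^sup>2 + 117) / n + 9 / n = (288 * B\<^sup>2 + 126) / n"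
      by (simp add: add_divide_distrib)
    moreover have "0 < 9 / real n" using n0 by simp
    ultimately show "\<bar>D (Suc j) - D j\<bar> \<le> (288 * B\<^sup>2 + 126) / n" using * by linarith
  qed
  also have "\<dots> \<le> (2 * B * w) * ((288 * B\<^sup>2 + 126) / n)"
    using a b by (intro mult_right_mono) (auto simp: w_def)
  also have "\<dots> = 2 * B * (288 * B\<^sup>2 + 126) / w" using w by (simp add: nw power2_eq_square)
  finally show ?thesis by (simp add: D_def w_def)
qed

text \<open>Normalised by a central term, not by the total: the size of the total becomes known only
  later, as the limit of \<open>scaled_moment 0\<close>.\<close>

definition rel_T :: "nat \<Rightarrow> int \<Rightarrow> real" where
  "rel_T n k = real (T_num n k) / real (T_num n (int (n div 3)))"

text \<open>Centre \<open>n / 3\<close> and scale \<open>sqrt (n / 18)\<close> are only approximations to the mean and the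
  standard deviation; they come from \<open>T(n,k+1) / T(n,k) \<approx> exp (- 18 (k - n / 3) / n)\<close>.\<close>

definition scaled_T :: "nat \<Rightarrow> real \<Rightarrow> real" where
  "scaled_T n u = rel_T n \<lfloor>n / 3 + u * sqrt (n / 18)\<rfloor>"

lemma T_num_mode_pos: "0 < real (T_num n (int (n div 3)))"
  using T_num_pos[of "n div 3" n] by simp

text \<open>The lattice point belonging to \<open>u\<close> is compared with \<open>n div 3\<close>.
  Both lie within (A + 1) sqrt n of n/3, the extra sqrt n absorbing the rounding, so the windowed
  estimate applies with B = A + 1.\<close>

lemma ln_scaled_T:
  assumes A: "0 \<le> A" "24 * (A + 1) \<le> sqrt n" and u: "\<bar>u\<bar> \<le> A"
  shows "0 < scaled_T n u"
    and "\<bar>ln (scaled_T n u) + u\<^sup>2 / 2\<bar> \<le> (2 * (A + 1) * (288 * (A + 1)\<^sup>2 + 126) + 18 * A + 18) / sqrt n"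
proof -
  define w where "w = sqrt n"
  have w: "24 \<le> w" and nw: "real n = w\<^sup>2" using A by (auto simp: w_def)
  have n0: "0 < real n" using w by (simp add: nw)
  define s where "s = sqrt (n / 18)"
  have s0: "0 < s" and s2: "s\<^sup>2 = n / 18" using n0 by (auto simp: s_def)
  have sw: "s \<le> w" unfolding s_def w_def by simp
  define m where "m = n div 3"
  define k where "k = nat \<lfloor>n / 3 + u * s\<rfloor>"
  have us: "\<bar>u * s\<bar> \<le> A * w" unfolding abs_mult using u s0 sw A(1) by (intro mult_mono) auto
  have "24 * (A + 1) * w \<le> w * w" using A(2) w unfolding w_def by (intro mult_right_mono) auto
  moreover have "0 \<le> A * w" using A w by simp
  ultimately have "A * w + w \<le> n / 3" unfolding nw power2_eq_square using w
    by (simp add: algebra_simps)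
  \<comment> \<open>Otherwise \<open>nat\<close> would truncate the floor to 0.\<close>
  then have "0 \<le> n / 3 + u * s" using us w by linarith
  then have fk: "\<lfloor>n / 3 + u * s\<rfloor> = int k" unfolding k_def by simp
  define \<theta> where "\<theta> = real k - n / 3 - u * s"
  have \<theta>: "\<bar>\<theta>\<bar> \<le> 1" using fk unfolding \<theta>_def by linarith
  have B: "1 \<le> A + 1" "24 * (A + 1) \<le> sqrt n" using A by auto
  have Aw: "(A + 1) * sqrt n = A * w + w" "0 \<le> A * w"
    using A w by (auto simp: w_def algebra_simps)
  have kB: "\<bar>real k - n / 3\<bar> \<le> (A + 1) * sqrt n"
    using \<theta> us w unfolding \<theta>_def Aw by linarith
  have m1: "\<bar>real m - n / 3\<bar> \<le> 1" unfolding m_def by linarith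
  have mB: "\<bar>real m - n / 3\<bar> \<le> (A + 1) * sqrt n"
    using m1 w Aw(2) unfolding Aw(1) by linarith
  have kpos: "0 < real (T_num n (int k))" using T_num_pos[OF ln_T_num_step(1)[OF B kB]] by simp
  have mpos: "0 < real (T_num n (int m))" using T_num_mode_pos by (simp add: m_def)
  have sc: "scaled_T n u = real (T_num n (int k)) / real (T_num n (int m))"
    using fk by (simp add: scaled_T_def rel_T_def s_def m_def)
  show "0 < scaled_T n u" using kpos mpos by (simp add: sc)
  have ln: "ln (scaled_T n u) = ln (real (T_num n (int k))) - ln (real (T_num n (int m)))"
    using kpos mpos by (simp add: sc ln_div)
  define E where "E = 2 * (A + 1) * (288 * (A + 1)\<^sup>2 + 126) / w"
  have "\<bar>(ln (real (T_num n (int k))) + 9 / n * (real k - n / 3)\<^sup>2)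
        - (ln (real (T_num n (int m))) + 9 / n * (real m - n / 3)\<^sup>2)\<bar> \<le> E"
    \<comment> \<open>The estimate wants its endpoints ordered, and \<open>k\<close> may lie on
      either side of \<open>m\<close>.\<close>
    using ln_T_num_diff[OF B _ kB mB] ln_T_num_diff[OF B _ mB kB]
    unfolding E_def w_def by (cases "k \<le> m") (auto simp: abs_minus_commute)
  moreover have n9: "9 / n \<le> 9 / w" "0 < 9 / n" 
    using w n0 by (auto simp: nw power2_eq_square divide_simps)
  have "(real m - n / 3)\<^sup>2 \<le> 1" using m1 by (simp add: abs_square_le_1)
  then have "\<bar>9 / n * (real m - n / 3)\<^sup>2\<bar> \<le> 9 / w"
    using n9 mult_left_mono[of "(real m - n / 3)\<^sup>2" 1 "9 / n"] by (simp add: abs_mult)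
  moreover have "\<bar>9 / n * (real k - n / 3)\<^sup>2 - u\<^sup>2 / 2\<bar> \<le> (18 * A + 9) / w"
  proof -
    \<comment> \<open>The scale satisfies s^2 = n/18, so 9/n (u s)^2 is exactly u^2/2 and only terms
      with the rounding error \<open>\<theta>\<close> survive.\<close>
    have "9 / n * (real k - n / 3)\<^sup>2 - u\<^sup>2 / 2 = 9 / n * (2 * (u * s) * \<theta> + \<theta>\<^sup>2)"
    proof -
      have "(real k - n / 3)\<^sup>2 = u\<^sup>2 * s\<^sup>2 + (2 * (u * s) * \<theta> + \<theta>\<^sup>2)"
        unfolding \<theta>_def by (simp add: power2_eq_square algebra_simps)
      then show ?thesis using n0 by (simp add: s2 field_simps)
    qed
    moreover have "\<bar>2 * (u * s) * \<theta> + \<theta>\<^sup>2\<bar> \<le> 2 * (A * w) * 1 + 1"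
    proof (rule order_trans[OF abs_triangle_ineq add_mono])
      show "\<bar>2 * (u * s) * \<theta>\<bar> \<le> 2 * (A * w) * 1"
        unfolding abs_mult[of _ \<theta>] using us \<theta> A w by (intro mult_mono) auto
      show "\<bar>\<theta>\<^sup>2\<bar> \<le> 1" using \<theta> by (simp add: abs_square_le_1)
    qed
    then have "\<bar>2 * (u * s) * \<theta> + \<theta>\<^sup>2\<bar> \<le> (2 * A + 1) * w" using w by (simp add: algebra_simps)
    ultimately have "\<bar>9 / n * (real k - n / 3)\<^sup>2 - u\<^sup>2 / 2\<bar> \<le> 9 / n * ((2 * A + 1) * w)"
      unfolding abs_mult using n0 by (simp only: abs_mult) (intro mult_mono, auto)
    also have "\<dots> = (18 * A + 9) / w" using w by (simp add: nw power2_eq_square field_simps)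
    finally show ?thesis .
  qed
  moreover have "(2 * (A + 1) * (288 * (A + 1)\<^sup>2 + 126) + 18 * A + 18) / w = E + 9 / w + (18 * A + 9) / w"
    unfolding E_def by (simp add: add_divide_distrib)
  ultimately show "\<bar>ln (scaled_T n u) + u\<^sup>2 / 2\<bar> \<le> (2 * (A + 1) * (288 * (A + 1)\<^sup>2 + 126) + 18 * A + 18) / sqrt n"
    unfolding ln w_def[symmetric] by linarith
qed

section \<open>Uniform convergence of the rescaled numbers to exp (-u^2/2)\<close>

lemma abs_exp_minus_one_le:
  fixes x :: real
  assumes "\<bar>x\<bar> \<le> 1"
  shows "\<bar>exp x - 1\<bar> \<le> 2 * \<bar>x\<bar>"
proof (cases "0 \<le> x")
  case True
  have "x\<^sup>2 \<le> x" unfolding power2_eq_square using True assms by (intro mult_left_le) auto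
  then show ?thesis using exp_bound[of x] exp_ge_add_one_self[of x] True assms by linarith
next
  case False
  then have "exp x \<le> 1" by simp
  then show ?thesis using exp_ge_add_one_self[of x] False by linarith
qed

text \<open>The error of the logarithm is K / sqrt n with K depending on \<open>A\<close> alone;
  once it is at most 1, exponentiating at most doubles it.\<close>

lemma scaled_T_locally_uniform:
  assumes "0 \<le> A" "0 < \<epsilon>"
  shows "\<forall>\<^sub>F n in sequentially. \<forall>u. \<bar>u\<bar> \<le> A \<longrightarrow> \<bar>scaled_T n u - exp (- (u\<^sup>2 / 2))\<bar> \<le> \<epsilon>"
proof -
  define K where "K = 2 * (A + 1) * (288 * (A + 1)\<^sup>2 + 126) + 18 * A + 18"
  have "(\<lambda>n. K / sqrt (real n)) \<longlonglongrightarrow> 0"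
    by real_asymp
  then have "\<forall>\<^sub>F n in sequentially. K / sqrt (real n) < min 1 (\<epsilon> / 2)"
    using assms by (intro order_tendstoD(2)) auto
  moreover have "\<forall>\<^sub>F n in sequentially. 24 * (A + 1) \<le> sqrt (real n)"
    by real_asymp
  ultimately show ?thesis
  proof eventually_elim
    case (elim n)
    show ?case
    proof (intro allI impI)
      fix u assume u: "\<bar>u\<bar> \<le> A"
      note l = ln_scaled_T[OF assms(1) elim(2) u, folded K_def]
      define \<delta> where "\<delta> = ln (scaled_T n u) + u\<^sup>2 / 2"
      have \<delta>: "\<bar>\<delta>\<bar> \<le> 1" "2 * \<bar>\<delta>\<bar> \<le> \<epsilon>" using l(2) elim(1) unfolding \<delta>_def[symmetric] min_less_iff_conj
        by (smt (verit) field_sum_of_halves)+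
      have "scaled_T n u = exp (- (u\<^sup>2 / 2)) * exp \<delta>"
        using l(1) by (simp add: \<delta>_def exp_add[symmetric])
      then have "scaled_T n u - exp (- (u\<^sup>2 / 2)) = exp (- (u\<^sup>2 / 2)) * (exp \<delta> - 1)"
        by (simp add: algebra_simps)
      then have "\<bar>scaled_T n u - exp (- (u\<^sup>2 / 2))\<bar> = exp (- (u\<^sup>2 / 2)) * \<bar>exp \<delta> - 1\<bar>"
        by (simp add: abs_mult)
      also have "\<dots> \<le> 1 * (2 * \<bar>\<delta>\<bar>)"
        using abs_exp_minus_one_le[OF \<delta>(1)] by (intro mult_mono) auto
      finally show "\<bar>scaled_T n u - exp (- (u\<^sup>2 / 2))\<bar> \<le> \<epsilon>" using \<delta> by simp
    qed
  qed
qed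

lemma rel_T_nonneg: "0 \<le> rel_T n k"
  by (simp add: rel_T_def)

lemma rel_T_eq_0: "k \<notin> {0..int n} \<Longrightarrow> rel_T n k = 0"
  using T_num_eq_0[of k n] by (auto simp: rel_T_def)

lemma scaled_T_nonneg: "0 \<le> scaled_T n u"
  by (simp add: scaled_T_def rel_T_nonneg)

lemma rel_T_le_gaussian:
  assumes "0 < n"
  shows "rel_T n k \<le> exp 12 * exp (- (3 / n * (real_of_int k - n / 3)\<^sup>2))"
proof (cases "0 \<le> k")
  case True
  then obtain j where "k = int j" using nonneg_eq_int by blast
  then show ?thesis
    using T_num_le_gaussian_nat[OF assms, of j] T_num_mode_pos[of n] by (simp add: rel_T_def field_simps)
qed (simp add: rel_T_eq_0)

text \<open>Without rounding the exponent would be u^2/6. Splitting off the rounding error by (a +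
  b)^2 <= 2a^2 + 2b^2 halves it to u^2/12, and the remaining 3/n <= 3 turns exp 12 into exp
  15.\<close>

lemma scaled_T_le_gaussian:
  assumes "0 < n"
  shows "scaled_T n u \<le> exp 15 * exp (- (u\<^sup>2 / 12))"
proof -
  define s where "s = sqrt (n / 18)"
  have s2: "s\<^sup>2 = n / 18" by (simp add: s_def)
  define k where "k = \<lfloor>n / 3 + u * s\<rfloor>"
  define \<theta> where "\<theta> = real_of_int k - n / 3 - u * s"
  have \<theta>: "\<bar>\<theta>\<bar> \<le> 1" unfolding \<theta>_def k_def by linarith
  have "(u * s)\<^sup>2 \<le> 2 * (u * s + \<theta>)\<^sup>2 + 2 * \<theta>\<^sup>2"
    using zero_le_power2[of "u * s + 2 * \<theta>"] by (simp add: power2_eq_square algebra_simps)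
  moreover have "\<theta>\<^sup>2 \<le> 1" using \<theta> by (simp add: abs_square_le_1)
  ultimately have "u\<^sup>2 * n / 18 \<le> 2 * (real_of_int k - n / 3)\<^sup>2 + 2"
    by (simp add: \<theta>_def power_mult_distrib s2)
  then have "3 / n * (u\<^sup>2 * n / 18) \<le> 3 / n * (2 * (real_of_int k - n / 3)\<^sup>2 + 2)"
    by (rule mult_left_mono) simp
  then have "u\<^sup>2 / 12 \<le> 3 / n * (real_of_int k - n / 3)\<^sup>2 + 3 / n"
    using assms by (simp add: field_simps)
  moreover have "3 / real n \<le> 3" using assms by (simp add: divide_simps)
  ultimately have *: "12 + - (3 / n * (real_of_int k - n / 3)\<^sup>2) \<le> 15 + - (u\<^sup>2 / 12)" by linarith
  have "scaled_T n u \<le> exp (12 + - (3 / n * (real_of_int k - n / 3)\<^sup>2))"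
    using rel_T_le_gaussian[OF assms, of k] unfolding exp_add by (simp add: scaled_T_def k_def s_def)
  also have "\<dots> \<le> exp (15 + - (u\<^sup>2 / 12))"
    using * by simp
  finally show ?thesis unfolding exp_add .
qed

lemma scaled_T_uniform:
  assumes "0 < \<epsilon>"
  shows "\<forall>\<^sub>F n in sequentially. \<forall>u. \<bar>scaled_T n u - exp (- (u\<^sup>2 / 2))\<bar> \<le> \<epsilon>"
proof -
  \<comment> \<open>Since A >= 1, |u| >= A gives u^2 >= A, so the dominating Gaussian is at most
    \<open>\<epsilon>\<close> there. Outside [-A, A] both nonnegative functions are then at most
    \<open>\<epsilon>\<close>, and so is their difference.\<close>
  define A where "A = 12 * (15 + \<bar>ln \<epsilon>\<bar>)"
  have A1: "1 \<le> A" by (simp add: A_def)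
  have tail: "exp 15 * exp (- (u\<^sup>2 / 12)) \<le> \<epsilon>" if "A \<le> \<bar>u\<bar>" for u :: real
  proof -
    have "A * 1 \<le> \<bar>u\<bar> * \<bar>u\<bar>" using that A1 by (intro mult_mono) auto
    then have "15 + - (u\<^sup>2 / 12) \<le> ln \<epsilon>" by (simp add: A_def power2_eq_square)
    then have "exp (15 + - (u\<^sup>2 / 12)) \<le> exp (ln \<epsilon>)" by (simp only: exp_le_cancel_iff)
    then show ?thesis using assms unfolding exp_add by simp
  qed
  have "\<forall>\<^sub>F n in sequentially. \<forall>u. \<bar>u\<bar> \<le> A \<longrightarrow> \<bar>scaled_T n u - exp (- (u\<^sup>2 / 2))\<bar> \<le> \<epsilon>"
    using A1 assms by (intro scaled_T_locally_uniform) auto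
  moreover have "\<forall>\<^sub>F n::nat in sequentially. 0 < n" by (rule eventually_gt_at_top)
  ultimately show ?thesis
  proof eventually_elim
    case (elim n)
    show ?case
    proof
      fix u
      show "\<bar>scaled_T n u - exp (- (u\<^sup>2 / 2))\<bar> \<le> \<epsilon>"
      proof (cases "\<bar>u\<bar> \<le> A")
        case False
        have "exp (- (u\<^sup>2 / 2)) \<le> exp 15 * exp (- (u\<^sup>2 / 12))"
          unfolding exp_add[symmetric] exp_le_cancel_iff using zero_le_power2[of u] by linarith
        then show ?thesis
          using tail[of u] False scaled_T_le_gaussian[OF elim(2), of u] scaled_T_nonneg[of n u]
          by (smt (verit) exp_ge_zero)
      qed (use elim in auto)
    qed
  qed
qed

lemma scaled_T_tendsto: "(\<lambda>n. scaled_T n u) \<longlonglongrightarrow> exp (- (u\<^sup>2 / 2))"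
proof (rule tendstoI)
  fix \<epsilon> :: real assume "0 < \<epsilon>"
  then have "\<forall>\<^sub>F n in sequentially. \<forall>u. \<bar>scaled_T n u - exp (- (u\<^sup>2 / 2))\<bar> \<le> \<epsilon> / 2"
    by (intro scaled_T_uniform) simp
  then show "\<forall>\<^sub>F n in sequentially. dist (scaled_T n u) (exp (- (u\<^sup>2 / 2))) < \<epsilon>"
  proof eventually_elim
    case (elim n)
    then have "\<bar>scaled_T n u - exp (- (u\<^sup>2 / 2))\<bar> \<le> \<epsilon> / 2" by blast
    then show ?case using \<open>0 < \<epsilon>\<close> by (simp add: dist_real_def)
  qed
qed

section \<open>Mean and variance\<close>

text \<open>The bridge from sums to integrals: the integrand is a step function, constant on the
  half-open intervals of length 1/s that the floor maps to a single integer.\<close>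

lemma has_bochner_integral_floor:
  fixes f :: "int \<Rightarrow> real"
  assumes S: "finite S" "\<And>k. k \<notin> S \<Longrightarrow> f k = 0" and s: "0 < s"
  shows "has_bochner_integral lborel (\<lambda>u. f \<lfloor>c + u * s\<rfloor>) ((\<Sum>k\<in>S. f k) / s)"
proof -
  define I where "I k = {(real_of_int k - c) / s..<(real_of_int k + 1 - c) / s}" for k
  have I: "u \<in> I k \<longleftrightarrow> \<lfloor>c + u * s\<rfloor> = k" for u k
    using s unfolding I_def floor_eq_iff by (auto simp: field_simps)
  have "has_bochner_integral lborel (indicat_real (I k)) (1 / s)" for k
  proof -
    have "(real_of_int k - c) / s \<le> (real_of_int k + 1 - c) / s"
      using s by (intro divide_right_mono) auto
    then have "has_bochner_integral lborel (indicat_real (I k)) (measure lborel (I k))"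
      by (intro has_bochner_integral_real_indicator) (auto simp: I_def)
    moreover have "measure lborel (I k) = 1 / s"
      using \<open>(real_of_int k - c) / s \<le> _\<close> by (simp add: I_def diff_divide_distrib[symmetric])
    ultimately show ?thesis by simp
  qed
  then have "has_bochner_integral lborel (\<lambda>u. \<Sum>k\<in>S. f k * indicat_real (I k) u) (\<Sum>k\<in>S. f k * (1 / s))"
    by (intro has_bochner_integral_sum has_bochner_integral_mult_right)
  moreover have "(\<Sum>k\<in>S. f k * indicat_real (I k) u) = f \<lfloor>c + u * s\<rfloor>" for u
  proof -
    have "(\<Sum>k\<in>S. f k * indicat_real (I k) u) = (\<Sum>k\<in>S. if k = \<lfloor>c + u * s\<rfloor> then f k else 0)"
      by (intro sum.cong) (auto simp: I indicator_def)
    then show ?thesis using S by (auto simp: sum.delta)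
  qed
  ultimately show ?thesis by (simp add: sum_divide_distrib)
qed

text \<open>The outer division by \<open>sqrt (n / 18)\<close> is the mesh width in the variable
  \<open>u\<close>, so this is the integral of a step function. Moments are unnormalised:
  \<open>scaled_moment 0\<close> plays the part of the total mass.\<close>

definition scaled_moment :: "nat \<Rightarrow> nat \<Rightarrow> real" where
  "scaled_moment j n =
    (\<Sum>k=0..int n. ((real_of_int k - n / 3) / sqrt (n / 18)) ^ j * rel_T n k) / sqrt (n / 18)"

lemma has_bochner_integral_scaled_moment:
  assumes "0 < n"
  shows "has_bochner_integral lborel
    (\<lambda>u. ((real_of_int \<lfloor>n / 3 + u * sqrt (n / 18)\<rfloor> - n / 3) / sqrt (n / 18)) ^ j * scaled_T n u) (scaled_moment j n)"
  unfolding scaled_moment_def scaled_T_def using assms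
  by (intro has_bochner_integral_floor[where f = "\<lambda>k. ((real_of_int k - n / 3) / sqrt (n / 18)) ^ j * rel_T n k"])
     (auto simp: rel_T_eq_0)

lemma scaled_moment_tendsto:
  assumes j: "j \<le> 2"
  shows "scaled_moment j \<longlonglongrightarrow> (LINT u|lborel. u ^ j * exp (- (u\<^sup>2 / 2)))"
proof -
  define F where "F n u = ((real_of_int \<lfloor>n / 3 + u * sqrt (n / 18)\<rfloor> - n / 3) / sqrt (n / 18)) ^ j * scaled_T n u"
    for n :: nat and u
  define w where "w u = exp 15 * (2 + 2 * u\<^sup>2) * exp (- (u\<^sup>2 / 12))" for u :: real
  have hb: "has_bochner_integral lborel (F n) (scaled_moment j n)" if "0 < n" for n
    using has_bochner_integral_scaled_moment[OF that] unfolding F_def .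
  \<comment> \<open>The shift by 18 makes the scale at least 1 for every index, so a rounding error
    of 1 costs at most 1 in \<open>u\<close> and one dominating function serves all terms.\<close>
  have "(\<lambda>n. LINT u|lborel. F (n + 18) u) \<longlonglongrightarrow> (LINT u|lborel. u ^ j * exp (- (u\<^sup>2 / 2)))"
  proof (rule integral_dominated_convergence[where w = w])
    show "F (n + 18) \<in> borel_measurable lborel" for n
      using borel_measurable_has_bochner_integral[OF hb[of "n + 18"]] by simp
    show "(\<lambda>u::real. u ^ j * exp (- (u\<^sup>2 / 2))) \<in> borel_measurable lborel" by measurable
    show "integrable lborel w"
    proof -
      \<comment> \<open>exp (-u^2/12) is, up to the factor sqrt (12 pi), the normal density of
        variance 6, so \<open>w\<close> combines its moments of order 0 and 2.\<close>
      have w: "w = (\<lambda>u. exp 15 * sqrt (12 * pi) * (2 * (normal_density 0 (sqrt 6) u * (u - 0) ^ 0) + 2 * (normal_density 0 (sqrt 6) u * (u - 0) ^ 2)))"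
        by (auto simp: w_def normal_density_def fun_eq_iff field_simps)
      show ?thesis unfolding w by (intro integrable_mult_right Bochner_Integration.integrable_add integrable_normal_moment) auto
    qed
    show "AE u in lborel. (\<lambda>n. F (n + 18) u) \<longlonglongrightarrow> u ^ j * exp (- (u\<^sup>2 / 2))"
    proof (rule AE_I2)
      fix u :: real
      have "(\<lambda>n::nat. (real_of_int \<lfloor>n / 3 + u * sqrt (n / 18)\<rfloor> - n / 3) / sqrt (n / 18) - u) \<longlonglongrightarrow> 0"
      proof (rule Lim_null_comparison)
        show "(\<lambda>n::nat. 1 / sqrt (n / 18)) \<longlonglongrightarrow> 0" by real_asymp
        show "\<forall>\<^sub>F n::nat in sequentially. norm ((real_of_int \<lfloor>n / 3 + u * sqrt (n / 18)\<rfloor> - n / 3) / sqrt (n / 18) - u) \<le> 1 / sqrt (n / 18)"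
          using eventually_gt_at_top[of "0::nat"]
        proof eventually_elim
          case (elim n)
          define s where "s = sqrt (n / 18)"
          have s: "0 < s" using elim by (simp add: s_def)
          have "\<bar>real_of_int \<lfloor>n / 3 + u * s\<rfloor> - n / 3 - u * s\<bar> \<le> 1" by linarith
          then have "\<bar>real_of_int \<lfloor>n / 3 + u * s\<rfloor> - n / 3 - u * s\<bar> / s \<le> 1 / s" using s by (intro divide_right_mono) auto
          moreover have "(real_of_int \<lfloor>n / 3 + u * s\<rfloor> - n / 3) / s - u = (real_of_int \<lfloor>n / 3 + u * s\<rfloor> - n / 3 - u * s) / s"
            using s by (simp add: diff_divide_distrib)
          ultimately show ?case using s unfolding s_def[symmetric] by (simp add: abs_divide)
        qed
      qed
      then have "(\<lambda>n::nat. (real_of_int \<lfloor>n / 3 + u * sqrt (n / 18)\<rfloor> - n / 3) / sqrt (n / 18)) \<longlonglongrightarrow> u"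
        by (rule LIM_zero_cancel)
      then have "(\<lambda>n. F n u) \<longlonglongrightarrow> u ^ j * exp (- (u\<^sup>2 / 2))"
        unfolding F_def by (intro tendsto_mult tendsto_power scaled_T_tendsto)
      then show "(\<lambda>n. F (n + 18) u) \<longlonglongrightarrow> u ^ j * exp (- (u\<^sup>2 / 2))"
        by (rule LIMSEQ_ignore_initial_segment)
    qed
    show "AE u in lborel. norm (F (n + 18) u) \<le> w u" for n
    proof (rule AE_I2)
      fix u :: real
      define N where "N = n + 18"
      define s where "s = sqrt (N / 18)"
      have s: "1 \<le> s" by (simp add: s_def N_def)
      define y where "y = (real_of_int \<lfloor>N / 3 + u * s\<rfloor> - N / 3) / s"
      have "\<bar>real_of_int \<lfloor>N / 3 + u * s\<rfloor> - N / 3\<bar> \<le> 1 + \<bar>u\<bar> * s"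
      proof -
        have "\<bar>u * s\<bar> = \<bar>u\<bar> * s" using s by (simp add: abs_mult)
        then show ?thesis by linarith
      qed
      also have "\<dots> \<le> (1 + \<bar>u\<bar>) * s" using s by (simp add: algebra_simps)
      finally have y: "\<bar>y\<bar> \<le> 1 + \<bar>u\<bar>" unfolding y_def abs_divide using s by (simp add: pos_divide_le_eq)
      have "\<bar>y ^ j\<bar> \<le> (1 + \<bar>u\<bar>) ^ j" unfolding power_abs using y by (intro power_mono) auto
      \<comment> \<open>The base is at least 1, so the square covers all orders
        \<open>j \<le> 2\<close> at once.\<close>
      also have "\<dots> \<le> (1 + \<bar>u\<bar>) ^ 2" using j by (intro power_increasing) auto
      also have "\<dots> \<le> 2 + 2 * u\<^sup>2"
        using zero_le_power2[of "1 - \<bar>u\<bar>"] by (simp add: power2_eq_square algebra_simps)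
      finally have "\<bar>y ^ j\<bar> * scaled_T N u \<le> (2 + 2 * u\<^sup>2) * (exp 15 * exp (- (u\<^sup>2 / 12)))"
        using scaled_T_le_gaussian[of N u] by (intro mult_mono) (auto simp: N_def scaled_T_nonneg)
      moreover have "norm (F (n + 18) u) = \<bar>y ^ j\<bar> * scaled_T N u"
        unfolding F_def N_def[symmetric] s_def[symmetric] y_def[symmetric] by (simp add: abs_mult scaled_T_nonneg)
      ultimately show "norm (F (n + 18) u) \<le> w u" by (simp add: w_def mult_ac)
    qed
  qed
  moreover have "(LINT u|lborel. F (n + 18) u) = scaled_moment j (n + 18)" for n
    using hb[of "n + 18"] by (simp add: has_bochner_integral_integral_eq)
  ultimately show ?thesis by (simp add: LIMSEQ_offset[where k = 18])
qed

lemma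
  shows scaled_moment_0: "scaled_moment 0 \<longlonglongrightarrow> sqrt (2 * pi)"
    and scaled_moment_1: "scaled_moment 1 \<longlonglongrightarrow> 0"
    and scaled_moment_2: "scaled_moment 2 \<longlonglongrightarrow> sqrt (2 * pi)"
proof -
  have *: "(LINT u|lborel. u ^ j * exp (- (u\<^sup>2 / 2))) = sqrt (2 * pi) * (LINT u|lborel. std_normal_density u * u ^ j)" for j
    by (subst integral_mult_right_zero[symmetric]) (auto simp: std_normal_density_def intro!: Bochner_Integration.integral_cong)
  show "scaled_moment 0 \<longlonglongrightarrow> sqrt (2 * pi)"
    using scaled_moment_tendsto[of 0] integral_std_normal_moment_even[of 0] unfolding * by simp
  show "scaled_moment 1 \<longlonglongrightarrow> 0"
    using scaled_moment_tendsto[of 1] integral_std_normal_moment_odd[of 0] unfolding * by simp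
  show "scaled_moment 2 \<longlonglongrightarrow> sqrt (2 * pi)"
    using scaled_moment_tendsto[of 2] integral_std_normal_moment_even[of 1] unfolding * by simp
qed

section \<open>Mean and standard deviation from the scaled moments\<close>

lemma p_T_eq_rel_T: "0 < n \<Longrightarrow> p_T n k = rel_T n k / (sqrt (n / 18) * scaled_moment 0 n)"
proof -
  assume "0 < n"
  have "(\<Sum>k=0..int n. rel_T n k) = real (\<Sum>k=0..int n. T_num n k) / real (T_num n (int (n div 3)))"
    by (simp add: rel_T_def sum_divide_distrib)
  then have "sqrt (n / 18) * scaled_moment 0 n = real (\<Sum>k=0..int n. T_num n k) / real (T_num n (int (n div 3)))"
    using \<open>0 < n\<close> by (simp add: scaled_moment_def)
  then show ?thesis
    using T_num_mode_pos[of n] by (simp add: p_T_def rel_T_def)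
qed

lemma sum_p_T_scaled:
  assumes "0 < n"
  shows "(\<Sum>k=0..int n. ((real_of_int k - n / 3) / sqrt (n / 18)) ^ j * p_T n k) = scaled_moment j n / scaled_moment 0 n"
proof -
  have "(\<Sum>k=0..int n. ((real_of_int k - n / 3) / sqrt (n / 18)) ^ j * p_T n k)
      = (\<Sum>k=0..int n. ((real_of_int k - n / 3) / sqrt (n / 18)) ^ j * rel_T n k) / (sqrt (n / 18) * scaled_moment 0 n)"
    unfolding p_T_eq_rel_T[OF assms] sum_divide_distrib by simp
  then show ?thesis by (simp add: scaled_moment_def[of j])
qed

lemma mean_T_scaled:
  assumes "0 < n"
  shows "(mean_T n - n / 3) / sqrt (n / 18) = scaled_moment 1 n / scaled_moment 0 n"
proof -
  have "scaled_moment 1 n / scaled_moment 0 n = (\<Sum>k=0..int n. (real_of_int k * p_T n k - n / 3 * p_T n k) / sqrt (n / 18))"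
    unfolding sum_p_T_scaled[OF assms, symmetric] by (intro sum.cong) (auto simp: algebra_simps diff_divide_distrib)
  also have "\<dots> = (mean_T n - n / 3) / sqrt (n / 18)"
    unfolding sum_divide_distrib[symmetric] sum_subtractf sum_distrib_left[symmetric] sum_p_T by (simp add: mean_T_def)
  finally show ?thesis by simp
qed

text \<open>The second moment about n/3 exceeds the variance by the squared distance of n/3 from the
  mean.\<close>

lemma variance_T_scaled:
  assumes "0 < n"
  shows "variance_T n / (n / 18) = scaled_moment 2 n / scaled_moment 0 n - (scaled_moment 1 n / scaled_moment 0 n)\<^sup>2"
proof -
  have "scaled_moment 2 n / scaled_moment 0 n
      = (\<Sum>k=0..int n. ((real_of_int k)\<^sup>2 * p_T n k - 2 * (n / 3) * (real_of_int k * p_T n k) + (n / 3)\<^sup>2 * p_T n k) / (n / 18))"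
    unfolding sum_p_T_scaled[OF assms, symmetric]
    by (intro sum.cong refl) (simp add: power_divide, simp add: power2_eq_square algebra_simps)
  also have "\<dots> = (variance_T n + (mean_T n - n / 3)\<^sup>2) / (n / 18)"
    unfolding sum_divide_distrib[symmetric] sum_subtractf sum.distrib sum_distrib_left[symmetric] sum_p_T
    unfolding mean_T_def[symmetric] variance_T_def
    by (simp add: power2_eq_square algebra_simps)
  also have "\<dots> = variance_T n / (n / 18) + ((mean_T n - n / 3) / sqrt (n / 18))\<^sup>2"
    by (simp add: add_divide_distrib power_divide)
  finally show ?thesis unfolding mean_T_scaled[OF assms] by simp
qed

lemma mean_T_asymp: "(\<lambda>n. (mean_T n - n / 3) / sqrt (n / 18)) \<longlonglongrightarrow> 0"
proof -
  have "(\<lambda>n. scaled_moment 1 n / scaled_moment 0 n) \<longlonglongrightarrow> 0 / sqrt (2 * pi)"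
    by (intro tendsto_divide scaled_moment_0 scaled_moment_1) auto
  moreover have "\<forall>\<^sub>F n in sequentially. scaled_moment 1 n / scaled_moment 0 n = (mean_T n - n / 3) / sqrt (n / 18)"
    using eventually_gt_at_top[of 0] by eventually_elim (simp only: mean_T_scaled)
  ultimately show ?thesis by (simp add: filterlim_cong)
qed

lemma stddev_T_asymp: "(\<lambda>n. stddev_T n / sqrt (n / 18)) \<longlonglongrightarrow> 1"
proof -
  have "(\<lambda>n. sqrt (scaled_moment 2 n / scaled_moment 0 n - (scaled_moment 1 n / scaled_moment 0 n)\<^sup>2))
      \<longlonglongrightarrow> sqrt (sqrt (2 * pi) / sqrt (2 * pi) - (0 / sqrt (2 * pi))\<^sup>2)"
    by (intro tendsto_real_sqrt tendsto_diff tendsto_power tendsto_divide scaled_moment_0 scaled_moment_1 scaled_moment_2) auto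
  moreover have "\<forall>\<^sub>F n in sequentially. sqrt (scaled_moment 2 n / scaled_moment 0 n - (scaled_moment 1 n / scaled_moment 0 n)\<^sup>2)
      = stddev_T n / sqrt (n / 18)"
    using eventually_gt_at_top[of 0]
  proof eventually_elim
    case (elim n)
    show ?case unfolding variance_T_scaled[OF elim, symmetric] stddev_T_def by (rule real_sqrt_divide)
  qed
  ultimately show ?thesis by (simp add: filterlim_cong)
qed

section \<open>The limit theorems\<close>

text \<open>Mean value theorem: the derivative -z exp (-z^2/2) is bounded by 1 because |z| <= 1 +
  z^2/2 <= exp (z^2/2). It later absorbs the gap between the true mean and n/3.\<close>

lemma abs_exp_neg_square_diff_le:
  fixes a b :: real
  shows "\<bar>exp (- (a\<^sup>2 / 2)) - exp (- (b\<^sup>2 / 2))\<bar> \<le> \<bar>a - b\<bar>"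
proof -
  have "\<bar>exp (- (y\<^sup>2 / 2)) - exp (- (x\<^sup>2 / 2))\<bar> \<le> \<bar>y - x\<bar>" if xy: "x < y" for x y :: real
  proof -
    have "\<exists>z>x. z < y \<and> exp (- (y\<^sup>2 / 2)) - exp (- (x\<^sup>2 / 2)) = (y - x) * (- z * exp (- (z\<^sup>2 / 2)))"
      by (rule MVT2[OF xy]) (auto intro!: derivative_eq_intros)
    then obtain z where z: "exp (- (y\<^sup>2 / 2)) - exp (- (x\<^sup>2 / 2)) = (y - x) * (- z * exp (- (z\<^sup>2 / 2)))"
      by blast
    have "\<bar>z\<bar> \<le> 1 + z\<^sup>2 / 2"
      using zero_le_power2[of "\<bar>z\<bar> - 1"] by (simp add: power2_eq_square algebra_simps)
    also have "\<dots> \<le> exp (z\<^sup>2 / 2)" by (rule exp_ge_add_one_self)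
    finally have "\<bar>- z * exp (- (z\<^sup>2 / 2))\<bar> \<le> 1"
      by (simp add: abs_mult exp_minus field_simps)
    then have "\<bar>y - x\<bar> * \<bar>- z * exp (- (z\<^sup>2 / 2))\<bar> \<le> \<bar>y - x\<bar> * 1"
      by (rule mult_left_mono) simp
    then show ?thesis unfolding z abs_mult by simp
  qed
  from this[of a b] this[of b a] show ?thesis
    by (cases a b rule: linorder_cases) (auto simp: abs_minus_commute)
qed

text \<open>Absorbs the ratio of the true to the approximate standard deviation, uniformly in
  \<open>x\<close>. The exponents differ by (t^2 - 1) x^2/2, which is unbounded; but t >= 1/2 keeps
  both at least x^2/8, and x^2/8 exp (-x^2/8) <= 1.\<close>

lemma abs_exp_neg_square_scale_le:
  fixes t x :: real
  assumes "1 / 2 \<le> t"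
  shows "\<bar>exp (- ((t * x)\<^sup>2 / 2)) - exp (- (x\<^sup>2 / 2))\<bar> \<le> 4 * \<bar>t\<^sup>2 - 1\<bar>"
proof -
  have *: "\<bar>exp (- q) - exp (- p)\<bar> \<le> \<bar>q - p\<bar> * exp (- r)" if "r \<le> p" "r \<le> q" for p q r :: real
  proof -
    have aux: "\<bar>exp (- q) - exp (- p)\<bar> \<le> \<bar>q - p\<bar> * exp (- r)" if "r \<le> p" "p \<le> q" for p q r :: real
    proof -
      have "exp (- p) - exp (- q) = exp (- p) * (1 - exp (p - q))"
        by (simp add: right_diff_distrib exp_add[symmetric])
      also have "1 - exp (p - q) \<le> q - p" using exp_ge_add_one_self[of "p - q"] by linarith
      then have "exp (- p) * (1 - exp (p - q)) \<le> exp (- r) * (q - p)"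
        using that by (intro mult_mono) auto
      finally show ?thesis using that by (simp add: mult_ac)
    qed
    from aux[of r p q] aux[of r q p] that show ?thesis by (cases "p \<le> q") (auto simp: abs_minus_commute)
  qed
  have "1 / 4 \<le> t\<^sup>2" using power_mono[OF assms, of 2] by (simp add: power2_eq_square)
  then have "1 / 4 * x\<^sup>2 \<le> t\<^sup>2 * x\<^sup>2" by (rule mult_right_mono) simp
  then have "\<bar>exp (- ((t * x)\<^sup>2 / 2)) - exp (- (x\<^sup>2 / 2))\<bar> \<le> \<bar>(t * x)\<^sup>2 / 2 - x\<^sup>2 / 2\<bar> * exp (- (x\<^sup>2 / 8))"
    by (intro *) (auto simp: power_mult_distrib)
  also have "(t * x)\<^sup>2 / 2 - x\<^sup>2 / 2 = (t\<^sup>2 - 1) * (x\<^sup>2 / 2)" by (simp add: power_mult_distrib algebra_simps)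
  also have "\<bar>(t\<^sup>2 - 1) * (x\<^sup>2 / 2)\<bar> * exp (- (x\<^sup>2 / 8)) = \<bar>t\<^sup>2 - 1\<bar> * (4 * (x\<^sup>2 / 8 * exp (- (x\<^sup>2 / 8))))"
    by (simp add: abs_mult)
  also have "x\<^sup>2 / 8 \<le> exp (x\<^sup>2 / 8)" using exp_ge_add_one_self[of "x\<^sup>2 / 8"] by linarith
  then have "x\<^sup>2 / 8 * exp (- (x\<^sup>2 / 8)) \<le> 1" by (simp add: exp_minus field_simps)
  then have "\<bar>t\<^sup>2 - 1\<bar> * (4 * (x\<^sup>2 / 8 * exp (- (x\<^sup>2 / 8)))) \<le> \<bar>t\<^sup>2 - 1\<bar> * (4 * 1)"
    by (intro mult_left_mono) auto
  finally show ?thesis by simp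
qed

section \<open>Local limit theorem\<close>

definition local_T :: "nat \<Rightarrow> real \<Rightarrow> real" where
  "local_T n x = stddev_T n * p_T n \<lfloor>mean_T n + x * stddev_T n\<rfloor>"

text \<open>Change of coordinates: the lattice point reached from the true mean and deviation is the
  one reached from n/3 and sqrt (n/18) at an affine image of \<open>x\<close>. That affine map tends
  to the identity, and the prefactor to 1 / sqrt (2 pi).\<close>

lemma local_T_eq:
  assumes "0 < n"
  shows "local_T n x = stddev_T n / sqrt (n / 18) / scaled_moment 0 n
     * scaled_T n ((mean_T n - n / 3) / sqrt (n / 18) + stddev_T n / sqrt (n / 18) * x)"
proof -
  have "n / 3 + ((mean_T n - n / 3) / sqrt (n / 18) + stddev_T n / sqrt (n / 18) * x) * sqrt (n / 18)
     = mean_T n + x * stddev_T n"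
    using assms by (simp add: distrib_right del: real_sqrt_divide real_sqrt_mult)
  then show ?thesis unfolding scaled_T_def local_T_def p_T_eq_rel_T[OF assms] by simp
qed

lemma local_T_uniform:
  assumes "0 < \<epsilon>"
  shows "\<forall>\<^sub>F n in sequentially. \<forall>x. \<bar>local_T n x - std_normal_density x\<bar> \<le> \<epsilon>"
proof -
  define d where "d n = (mean_T n - n / 3) / sqrt (n / 18)" for n :: nat
  define t where "t n = stddev_T n / sqrt (n / 18)" for n :: nat
  define r where "r n = t n / scaled_moment 0 n" for n :: nat
  define c where "c = 1 / sqrt (2 * pi)"
  \<comment> \<open>Ensures \<open>r n < 1\<close> eventually, so the prefactor can be bounded by 1
    in the error estimate.\<close>
  have c: "c < 1" using pi_gt3 by (simp add: c_def)
  have d: "d \<longlonglongrightarrow> 0" unfolding d_def by (rule mean_T_asymp)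
  have t: "t \<longlonglongrightarrow> 1" unfolding t_def by (rule stddev_T_asymp)
  have r: "r \<longlonglongrightarrow> c" unfolding r_def c_def by (intro tendsto_divide t scaled_moment_0) auto
  have "(\<lambda>n. \<bar>d n\<bar> + 4 * \<bar>(t n)\<^sup>2 - 1\<bar> + \<bar>r n - c\<bar>) \<longlonglongrightarrow> \<bar>0\<bar> + 4 * \<bar>1\<^sup>2 - 1\<bar> + \<bar>c - c\<bar>"
    by (intro tendsto_intros d t r)
  then have "\<forall>\<^sub>F n in sequentially. \<bar>d n\<bar> + 4 * \<bar>(t n)\<^sup>2 - 1\<bar> + \<bar>r n - c\<bar> < \<epsilon> / 2"
    using assms by (intro order_tendstoD(2)) auto
  moreover have "\<forall>\<^sub>F n in sequentially. \<forall>u. \<bar>scaled_T n u - exp (- (u\<^sup>2 / 2))\<bar> \<le> \<epsilon> / 2"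
    using assms by (intro scaled_T_uniform) simp
  moreover have "\<forall>\<^sub>F n in sequentially. r n < 1" by (rule order_tendstoD(2)[OF r c])
  moreover have "\<forall>\<^sub>F n in sequentially. 0 < r n" by (rule order_tendstoD(1)[OF r]) (simp add: c_def)
  moreover have "\<forall>\<^sub>F n in sequentially. 1 / 2 < t n" by (rule order_tendstoD(1)[OF t]) simp
  moreover have "\<forall>\<^sub>F n::nat in sequentially. 0 < n" by (rule eventually_gt_at_top)
  ultimately show ?thesis
  proof eventually_elim
    case (elim n)
    show ?case
    proof
      fix x
      define e where "e u = exp (- (u\<^sup>2 / 2))" for u :: real
      define v where "v = d n + t n * x"
      have 1: "local_T n x = r n * scaled_T n v"
        unfolding local_T_eq[OF elim(6)] r_def t_def v_def d_def ..
      have 2: "std_normal_density x = c * e x" by (simp add: std_normal_density_def c_def e_def)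
      have "local_T n x - std_normal_density x = r n * (scaled_T n v - e x) + (r n - c) * e x"
        unfolding 1 2 by (simp add: algebra_simps)
      moreover have "\<bar>r n * (scaled_T n v - e x)\<bar> \<le> 1 * \<bar>scaled_T n v - e x\<bar>"
        unfolding abs_mult using elim by (intro mult_right_mono) auto
      moreover have "\<bar>(r n - c) * e x\<bar> \<le> \<bar>r n - c\<bar> * 1"
        unfolding abs_mult by (intro mult_left_mono) (auto simp: e_def)
      \<comment> \<open>Passes from \<open>v\<close> through \<open>t n * x\<close> to
        \<open>x\<close>: first the limit profile, then the shift, then the rescaling.\<close>
      moreover have "\<bar>scaled_T n v - e x\<bar> \<le> \<epsilon> / 2 + \<bar>d n\<bar> + 4 * \<bar>(t n)\<^sup>2 - 1\<bar>"
      proof -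
        have "\<bar>scaled_T n v - e v\<bar> \<le> \<epsilon> / 2" using elim by (simp add: e_def)
        moreover have "\<bar>e v - e (t n * x)\<bar> \<le> \<bar>d n\<bar>"
          using abs_exp_neg_square_diff_le[of v "t n * x"] by (simp add: e_def v_def)
        moreover have "\<bar>e (t n * x) - e x\<bar> \<le> 4 * \<bar>(t n)\<^sup>2 - 1\<bar>"
          unfolding e_def using elim by (intro abs_exp_neg_square_scale_le) simp
        ultimately show ?thesis by linarith
      qed
      moreover note abs_triangle_ineq[of "r n * (scaled_T n v - e x)" "(r n - c) * e x"]
      ultimately show "\<bar>local_T n x - std_normal_density x\<bar> \<le> \<epsilon>"
        using elim(1) by (smt (verit) field_sum_of_halves)
    qed
  qed
qed

lemma SUP_ereal_tendsto_0:
  fixes f :: "nat \<Rightarrow> 'a \<Rightarrow> real"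
  assumes "\<And>\<epsilon>. 0 < \<epsilon> \<Longrightarrow> \<forall>\<^sub>F n in sequentially. \<forall>x. \<bar>f n x\<bar> \<le> \<epsilon>"
  shows "(\<lambda>n. SUP x. ereal \<bar>f n x\<bar>) \<longlonglongrightarrow> 0"
proof (rule order_tendstoI)
  fix a :: ereal assume a: "a < 0"
  have "0 \<le> (SUP x. ereal \<bar>f n x\<bar>)" for n
    \<comment> \<open>Any point will do as a witness: every term is nonnegative and the index type
      is inhabited.\<close>
    by (rule SUP_upper2[of undefined]) auto
  then show "\<forall>\<^sub>F n in sequentially. a < (SUP x. ereal \<bar>f n x\<bar>)"
    using a by (intro always_eventually allI) (rule less_le_trans)
next
  fix a :: ereal assume "0 < a"
  then obtain \<epsilon> where \<epsilon>: "0 < ereal \<epsilon>" "ereal \<epsilon> < a" using ereal_dense2 by blast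
  then have "\<forall>\<^sub>F n in sequentially. \<forall>x. \<bar>f n x\<bar> \<le> \<epsilon>" by (intro assms) simp
  then show "\<forall>\<^sub>F n in sequentially. (SUP x. ereal \<bar>f n x\<bar>) < a"
  proof eventually_elim
    case (elim n)
    then have "(SUP x. ereal \<bar>f n x\<bar>) \<le> ereal \<epsilon>" by (intro SUP_least) auto
    then show ?case using \<epsilon>(2) by (rule le_less_trans)
  qed
qed

section \<open>Central limit theorem through convergence in L^1\<close>

lemma stddev_T_eventually_pos: "\<forall>\<^sub>F n in sequentially. 0 < stddev_T n"
  using order_tendstoD(1)[OF stddev_T_asymp zero_less_one] eventually_gt_at_top[of 0]
  by eventually_elim (simp add: zero_less_divide_iff)

lemma inverse_stddev_T_tendsto: "(\<lambda>n. 1 / stddev_T n) \<longlonglongrightarrow> 0"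
proof (rule Lim_transform_eventually)
  have "(\<lambda>n. 1 / sqrt (real n / 18)) \<longlonglongrightarrow> 0" by real_asymp
  from tendsto_divide[OF this stddev_T_asymp]
  show "(\<lambda>n. (1 / sqrt (real n / 18)) / (stddev_T n / sqrt (n / 18))) \<longlonglongrightarrow> 0" by simp
  show "\<forall>\<^sub>F n in sequentially. (1 / sqrt (real n / 18)) / (stddev_T n / sqrt (n / 18)) = 1 / stddev_T n"
    using eventually_gt_at_top[of 0] by eventually_elim (simp del: real_sqrt_divide)
qed

text \<open>Steps of height \<open>stddev_T n * p_T n k\<close> and width
  \<open>1 / stddev_T n\<close> have total mass 1, so \<open>local_T n\<close> is a probability
  density and Scheffe's lemma becomes available.\<close>

lemma has_bochner_integral_local_T:
  assumes "0 < stddev_T n"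
  shows "has_bochner_integral lborel (local_T n) 1"
proof -
  have "has_bochner_integral lborel (\<lambda>x. stddev_T n * p_T n \<lfloor>mean_T n + x * stddev_T n\<rfloor>)
      (stddev_T n * ((\<Sum>k=0..int n. p_T n k) / stddev_T n))"
    using assms by (intro has_bochner_integral_mult_right has_bochner_integral_floor) (auto simp: p_T_eq_0)
  then show ?thesis using assms by (simp add: sum_p_T local_T_def[abs_def])
qed

lemma local_T_tendsto_L1: "(\<lambda>n. LINT x|lborel. \<bar>local_T n x - std_normal_density x\<bar>) \<longlonglongrightarrow> 0"
proof -
  \<comment> \<open>Scheffe's lemma speaks about every index, so the sequence is shifted past the
    finitely many where the deviation may vanish.\<close>
  obtain N where N: "\<And>n. N \<le> n \<Longrightarrow> 0 < stddev_T n"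
    using stddev_T_eventually_pos unfolding eventually_sequentially by blast
  have int: "integrable lborel (local_T (n + N))" for n
    by (rule integrable.intros, rule has_bochner_integral_local_T, rule N) simp
  have nn: "(\<integral>\<^sup>+ x. norm (f x) \<partial>lborel) = 1"
    if "has_bochner_integral lborel f 1" "\<And>x. 0 \<le> f x" for f :: "real \<Rightarrow> real"
    using that by (simp add: nn_integral_eq_integral integrable.intros has_bochner_integral_integral_eq)
  have phi: "has_bochner_integral lborel std_normal_density 1"
    using std_normal_moment_even[of 0] by simp
  have "(\<lambda>n. \<integral>\<^sup>+ x. norm (local_T (n + N) x - std_normal_density x) \<partial>lborel) \<longlonglongrightarrow> 0"
  proof (rule Scheffe_lemma2)
    show "local_T (n + N) \<in> borel_measurable lborel" for n using int by (rule borel_measurable_integrable)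
    show "integrable lborel std_normal_density" using phi by (rule integrable.intros)
    show "AE x in lborel. (\<lambda>n. local_T (n + N) x) \<longlonglongrightarrow> std_normal_density x"
    proof (intro AE_I2 LIMSEQ_ignore_initial_segment tendstoI)
      fix x \<epsilon> :: real assume "0 < \<epsilon>"
      then have "\<forall>\<^sub>F n in sequentially. \<forall>x. \<bar>local_T n x - std_normal_density x\<bar> \<le> \<epsilon> / 2"
        by (intro local_T_uniform) simp
      then show "\<forall>\<^sub>F n in sequentially. dist (local_T n x) (std_normal_density x) < \<epsilon>"
      proof eventually_elim
        case (elim n)
        then have "\<bar>local_T n x - std_normal_density x\<bar> \<le> \<epsilon> / 2" by blast
        then show ?case using \<open>0 < \<epsilon>\<close> by (simp add: dist_real_def)
      qed
    qed
    show "(\<integral>\<^sup>+ x. norm (local_T (n + N) x) \<partial>lborel) \<le> (\<integral>\<^sup>+ x. norm (std_normal_density x) \<partial>lborel)" for n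
    proof -
      have "0 \<le> local_T (n + N) x" for x
        using N[of "n + N"] by (simp add: local_T_def p_T_nonneg)
      then show ?thesis
        using nn[OF has_bochner_integral_local_T[OF N[of "n + N"]]] nn[OF phi] by simp
    qed
  qed
  then have "(\<lambda>n. enn2real (\<integral>\<^sup>+ x. norm (local_T (n + N) x - std_normal_density x) \<partial>lborel)) \<longlonglongrightarrow> enn2real 0"
    by (intro tendsto_enn2real) auto
  then have "(\<lambda>n. LINT x|lborel. \<bar>local_T (n + N) x - std_normal_density x\<bar>) \<longlonglongrightarrow> 0"
    using int by (subst integral_eq_nn_integral) (auto intro!: borel_measurable_abs borel_measurable_diff borel_measurable_integrable)
  then show ?thesis by (rule LIMSEQ_offset)
qed

text \<open>As a function of \<open>v\<close>, the truncated density \<open>h\<close> below agrees with \<open>local_T n\<close> left of \<open>x\<close> and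
  vanishes right of \<open>x + 1 / \<sigma>\<close>, so rounding only costs the mass of an interval of length \<open>1 / \<sigma>\<close>.\<close>

lemma cdf_T_diff_le:
  assumes s: "0 < stddev_T n"
  shows "\<bar>cdf_T n (mean_T n + x * stddev_T n) - (LINT t:{..x}|lborel. std_normal_density t)\<bar>
    \<le> (LINT x|lborel. \<bar>local_T n x - std_normal_density x\<bar>) + 1 / stddev_T n"
proof -
  define y where "y = mean_T n + x * stddev_T n"
  define f where "f k = (if real_of_int k \<le> y then stddev_T n * p_T n k else 0)" for k
  define h where "h v = f \<lfloor>mean_T n + v * stddev_T n\<rfloor>" for v
  define g where "g = (\<lambda>v. indicat_real {..x} v * std_normal_density v)"
  define I where "I = {x..x + 1 / stddev_T n}"
  have "(\<Sum>k=0..int n. f k) / stddev_T n = cdf_T n y"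
  proof -
    have "(\<Sum>k=0..int n. f k) = (\<Sum>k | k \<in> {0..int n} \<and> real_of_int k \<le> y. stddev_T n * p_T n k)"
      unfolding f_def by (subst sum.inter_filter[symmetric]) auto
    then show ?thesis using s by (simp add: cdf_T_def sum_distrib_left[symmetric])
  qed
  then have h: "has_bochner_integral lborel h (cdf_T n y)"
    using has_bochner_integral_floor[of "{0..int n}" f "stddev_T n" "mean_T n"] s
    unfolding h_def f_def by (auto simp: p_T_eq_0)
  have phi: "integrable lborel std_normal_density"
    using integrable_std_normal_moment[of 0] by simp
  have G: "integrable lborel (local_T n)"
    using has_bochner_integral_local_T[OF s] by (rule integrable.intros)
  have g: "integrable lborel g"
    unfolding g_def using integrable_mult_indicator[OF _ phi, of "{..x}"] by simp
  have I: "has_bochner_integral lborel (indicat_real I) (1 / stddev_T n)"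
    using has_bochner_integral_real_indicator[of I lborel] s by (simp add: I_def)
  have le: "\<bar>h v - g v\<bar> \<le> \<bar>local_T n v - std_normal_density v\<bar> + indicat_real I v" for v
  proof -
    have phi01: "0 \<le> std_normal_density v" "std_normal_density v \<le> 1"
    proof -
      have "1 / sqrt (2 * pi) * exp (- v\<^sup>2 / 2) \<le> 1 * 1"
        using pi_gt3 by (intro mult_mono) auto
      then show "std_normal_density v \<le> 1" by (simp add: std_normal_density_def)
    qed simp
    consider "v < x" | "x \<le> v" "v \<le> x + 1 / stddev_T n" | "x + 1 / stddev_T n < v" by linarith
    then show ?thesis
    proof cases
      case 1
      then have "v * stddev_T n \<le> x * stddev_T n" using s by (intro mult_right_mono) auto
      then have "real_of_int \<lfloor>mean_T n + v * stddev_T n\<rfloor> \<le> y" unfolding y_def by linarith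
      then show ?thesis using 1 by (simp add: h_def f_def g_def local_T_def indicator_def)
    next
      case 2
      \<comment> \<open>Each function may or may not be cut off here. In the worst case one of them
        survives alone, and the indicator covers the discrepancy because the normal density is at
        most 1.\<close>
      have "h v = local_T n v \<or> h v = 0" by (simp add: h_def f_def local_T_def)
      moreover have "0 \<le> local_T n v" using s by (simp add: local_T_def p_T_nonneg)
      moreover have "g v = std_normal_density v \<or> g v = 0" by (simp add: g_def indicator_def)
      moreover have "indicat_real I v = 1" using 2 by (simp add: I_def)
      ultimately show ?thesis using phi01 by auto
    next
      case 3
      then have "(x + 1 / stddev_T n) * stddev_T n < v * stddev_T n" using s by (intro mult_strict_right_mono) auto
      then have "y + 1 < mean_T n + v * stddev_T n" using s unfolding y_def by (simp add: distrib_right)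
      then have "\<not> real_of_int \<lfloor>mean_T n + v * stddev_T n\<rfloor> \<le> y" by linarith
      moreover have "x < v" using 3 s by (smt (verit) divide_pos_pos)
      ultimately show ?thesis by (simp add: h_def f_def g_def)
    qed
  qed
  have "cdf_T n y - (LINT t:{..x}|lborel. std_normal_density t) = (LINT v|lborel. h v - g v)"
    using h g by (subst Bochner_Integration.integral_diff)
      (auto simp: integrable.intros has_bochner_integral_integral_eq set_lebesgue_integral_def g_def)
  also have "\<bar>\<dots>\<bar> \<le> (LINT v|lborel. \<bar>h v - g v\<bar>)"
    by (rule integral_abs_bound)
  also have "\<dots> \<le> (LINT v|lborel. \<bar>local_T n v - std_normal_density v\<bar> + indicat_real I v)"
    using h g G phi I le
    by (intro integral_mono integrable_abs Bochner_Integration.integrable_diff Bochner_Integration.integrable_add)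
       (auto intro: integrable.intros)
  also have "\<dots> = (LINT v|lborel. \<bar>local_T n v - std_normal_density v\<bar>) + (LINT v|lborel. indicat_real I v)"
    using G phi I by (intro Bochner_Integration.integral_add) (auto intro: integrable.intros)
  also have "(LINT v|lborel. indicat_real I v) = 1 / stddev_T n"
    by (rule has_bochner_integral_integral_eq[OF I])
  finally show ?thesis by (simp add: y_def)
qed

lemma cdf_T_uniform:
  assumes "0 < \<epsilon>"
  shows "\<forall>\<^sub>F n in sequentially. \<forall>x. \<bar>cdf_T n (mean_T n + x * stddev_T n) - (LINT t:{..x}|lborel. std_normal_density t)\<bar> \<le> \<epsilon>"
proof -
  have "(\<lambda>n. (LINT x|lborel. \<bar>local_T n x - std_normal_density x\<bar>) + 1 / stddev_T n) \<longlonglongrightarrow> 0 + 0"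
    by (intro tendsto_add local_T_tendsto_L1 inverse_stddev_T_tendsto)
  then have "\<forall>\<^sub>F n in sequentially. (LINT x|lborel. \<bar>local_T n x - std_normal_density x\<bar>) + 1 / stddev_T n < \<epsilon>"
    using assms by (intro order_tendstoD(2)) auto
  then show ?thesis
    using stddev_T_eventually_pos
  proof eventually_elim
    case (elim n)
    then show ?case using cdf_T_diff_le[OF elim(2)] by (meson less_imp_le order_trans)
  qed
qed

theorem theorem2p4:
  shows "((\<lambda>n::nat. SUP x::real.
            ereal \<bar>cdf_T n (mean_T n + x * stddev_T n)
                   - 1 / sqrt (2 * pi) * (LINT t:{..x}|lborel. exp (- (t\<^sup>2) / 2))\<bar>)
          \<longlonglongrightarrow> 0)
       \<and> ((\<lambda>n::nat. SUP x::real.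
            ereal \<bar>stddev_T n * p_T n \<lfloor>mean_T n + x * stddev_T n\<rfloor>
                   - 1 / sqrt (2 * pi) * exp (- (x\<^sup>2) / 2)\<bar>)
          \<longlonglongrightarrow> 0)"
proof
  have "1 / sqrt (2 * pi) * (LINT t:{..x}|lborel. exp (- (t\<^sup>2) / 2)) = (LINT t:{..x}|lborel. std_normal_density t)" for x :: real
    unfolding std_normal_density_def by (rule set_integral_mult_right[symmetric])
  then show "(\<lambda>n::nat. SUP x::real.
            ereal \<bar>cdf_T n (mean_T n + x * stddev_T n)
                   - 1 / sqrt (2 * pi) * (LINT t:{..x}|lborel. exp (- (t\<^sup>2) / 2))\<bar>) \<longlonglongrightarrow> 0"
    by (simp only:) (intro SUP_ereal_tendsto_0 cdf_T_uniform)
  show "(\<lambda>n::nat. SUP x::real.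
            ereal \<bar>stddev_T n * p_T n \<lfloor>mean_T n + x * stddev_T n\<rfloor>
                   - 1 / sqrt (2 * pi) * exp (- (x\<^sup>2) / 2)\<bar>) \<longlonglongrightarrow> 0"
    unfolding std_normal_density_def[symmetric] local_T_def[symmetric]
    by (intro SUP_ereal_tendsto_0 local_T_uniform)
qed

end
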